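(* Let $\epsilon>0$, and let $\mathcal H\subseteq\{\pm1\}^{\mathcal X}$ be a hypothesis class with strong SQ dimension $d_{\mathrm{SQ}}=\mathtt{dim}_{\mathrm{SQ}}(\mathcal H,2\epsilon)\ge11$ (with respect to a fixed distribution $D$ over $\mathcal X$). Let $\mathsf{Alg}$ be any interactive estimation algorithm (in the SQ setting) with the property that for any target $h^*\in\mathcal H$, $\mathsf{Alg}$ outputs an $\epsilon$-approximation to $h^*$ with probability at least $2/3$ using at most $m$ queries. Then $m>\sqrt[3]{d_{\mathrm{SQ}}}/12$.
   Context: For $h,h':\mathcal X\to\{\pm1\}$ write $\langle h,h'\rangle=\mathbb E_{x\sim D}[h(x)h'(x)]$. Strong SQ dimension: $\mathtt{dim}_{\mathrm{SQ}}(\mathcal H,\epsilon)$ is the largest number $d$ for which there exist $h_1,\dots,h_d\in\mathcal H$ such that (a) $|\langle h_i,h_j\rangle|\le1-\epsilon$ for all $1\le i<j\le d$, and (b) $|\langle h_i,h_j\rangle-\langle h_{i'},h_{j'}\rangle|\le\frac1d$ for all $1\le i<j\le d$ and $1\le i'<j'\le d$. SQ setting of interactive estimation (stochastic correlational queries): $D$ and $\mathcal H$ are known to the learner, the target $h^*\in\mathcal H$ is unknown. A (possibly randomized, adaptive) algorithm repeatedly submits a query $h\in\mathcal H$ to a sample oracle, which draws a fresh independent $x\sim D$ and returns $h(x)h^*(x)$ (so the response has expectation $\langle h,h^*\rangle$). At the end the algorithm outputs a hypothesis $\hat h\in\mathcal H$; it is an $\epsilon$-approximation to $h^*$ if $\langle\hat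 h,h^*\rangle\ge1-\epsilon$.
   Formalization: An ε-approximation is taken to mean ⟨ĥ,h*⟩ > 1−ε (strict) instead of ≥ 1−ε; with ≥ the claim fails: on 12 uniform points with ε=1/6, the constant 1 is within ε of 11 single-point flips that are pairwise at correlation exactly 1−2ε, so 0 queries suffice. *)

theory Defs
  imports "HOL-Probability.Probability" "HOL-Library.Extended_Nat"
begin

definition corr :: "'x measure \<Rightarrow> ('x \<Rightarrow> real) \<Rightarrow> ('x \<Rightarrow> real) \<Rightarrow> real" where
  "corr D h h' = (\<integral>x. h x * h' x \<partial>D)"

definition hypothesis_class :: "'x measure \<Rightarrow> ('x \<Rightarrow> real) set \<Rightarrow> bool" where
  "hypothesis_class D H \<longleftrightarrow> H \<subseteq> D \<rightarrow>\<^sub>M count_space {-1, 1}"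

definition strong_SQ_family ::
    "'x measure \<Rightarrow> ('x \<Rightarrow> real) set \<Rightarrow> real \<Rightarrow> nat \<Rightarrow> (nat \<Rightarrow> 'x \<Rightarrow> real) \<Rightarrow> bool" where
  "strong_SQ_family D H \<epsilon> d h \<longleftrightarrow>
     (\<forall>i\<in>{1..d}. h i \<in> H) \<and>
     (\<forall>i j. 1 \<le> i \<and> i < j \<and> j \<le> d \<longrightarrow> \<bar>corr D (h i) (h j)\<bar> \<le> 1 - \<epsilon>) \<and>
     (\<forall>i j i' j'. 1 \<le> i \<and> i < j \<and> j \<le> d \<and> 1 \<le> i' \<and> i' < j' \<and> j' \<le> d \<longrightarrow>
        \<bar>corr D (h i) (h j) - corr D (h i') (h j')\<bar> \<le> 1 / real d)"

text \<open>
  The largest size of such a family, and infinity if there are families of every size.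
\<close>

definition strong_SQ_dim :: "'x measure \<Rightarrow> ('x \<Rightarrow> real) set \<Rightarrow> real \<Rightarrow> enat" where
  "strong_SQ_dim D H \<epsilon> = Sup {enat d |d. \<exists>h. strong_SQ_family D H \<epsilon> d h}"

datatype 'h action = Query (hyp: 'h) | Output (hyp: 'h)

text \<open>
  All internal randomness is a seed \<open>w\<close> drawn once from \<open>S\<close>.  Given the seed and the list of
  responses received so far, \<open>A w rs\<close> is the next action; the earlier queries need not be recorded,
  since they are determined by \<open>w\<close> and the earlier responses.  The joint measurability makes the
  response to a random query a random variable.
\<close>

definition sq_algorithm ::
    "'x measure \<Rightarrow> ('x \<Rightarrow> real) set \<Rightarrow> 'w measure \<Rightarrow>
     ('w \<Rightarrow> real list \<Rightarrow> ('x \<Rightarrow> real) action) \<Rightarrow> bool" where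
  "sq_algorithm D H S A \<longleftrightarrow>
     prob_space S \<and>
     (\<forall>rs. set rs \<subseteq> {-1, 1} \<longrightarrow>
        (\<forall>w\<in>space S. hyp (A w rs) \<in> H) \<and>
        {w \<in> space S. is_Query (A w rs)} \<in> sets S \<and>
        (\<lambda>(w, x). hyp (A w rs) x) \<in> S \<Otimes>\<^sub>M D \<rightarrow>\<^sub>M count_space {-1, 1})"

text \<open>
  \<open>sq_output A t w xs n rs\<close> is the hypothesis output on target \<open>t\<close>, seed \<open>w\<close> and oracle samples
  \<open>xs\<close>, starting from the responses \<open>rs\<close>, if the algorithm stops after at most \<open>n\<close> further queries.
  The query made after \<open>k\<close> responses is answered with the sample \<open>xs k\<close>.
\<close>

fun sq_output ::
    "('w \<Rightarrow> real list \<Rightarrow> ('x \<Rightarrow> real) action) \<Rightarrow> ('x \<Rightarrow> real) \<Rightarrow> 'w \<Rightarrow> (nat \<Rightarrow> 'x) \<Rightarrow>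
     nat \<Rightarrow> real list \<Rightarrow> ('x \<Rightarrow> real) option" where
  "sq_output A t w xs 0 rs =
     (case A w rs of Output g \<Rightarrow> Some g | Query h \<Rightarrow> None)"
| "sq_output A t w xs (Suc n) rs =
     (case A w rs of
        Output g \<Rightarrow> Some g
      | Query h \<Rightarrow>
          sq_output A t w xs n (rs @ [h (xs (length rs)) * t (xs (length rs))]))"

definition run_space :: "'x measure \<Rightarrow> 'w measure \<Rightarrow> ('w \<times> (nat \<Rightarrow> 'x)) measure" where
  "run_space D S = S \<Otimes>\<^sub>M (\<Pi>\<^sub>M k\<in>UNIV. D)"

text \<open>
  The inequality is strict here, while the separation in \<open>strong_SQ_family\<close> is not.  With both
  non-strict, one \<open>g\<close> can approximate unboundedly many members of a \<open>2 * \<epsilon>\<close>-separated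
  family: flip \<open>g\<close> on pairwise disjoint sets of probability \<open>\<epsilon> / 2\<close>.  Then \<open>g\<close> has correlation
  exactly \<open>1 - \<epsilon>\<close> with each flipped function, any two of which have correlation exactly
  \<open>1 - 2 * \<epsilon>\<close>, so no queries are needed to learn the family together with \<open>g\<close>.
\<close>

definition approximates ::
    "'x measure \<Rightarrow> real \<Rightarrow> ('x \<Rightarrow> real) \<Rightarrow> ('x \<Rightarrow> real) \<Rightarrow> bool" where
  "approximates D \<epsilon> t g \<longleftrightarrow> corr D g t > 1 - \<epsilon>"

definition success_prob ::
    "'x measure \<Rightarrow> 'w measure \<Rightarrow> ('w \<Rightarrow> real list \<Rightarrow> ('x \<Rightarrow> real) action) \<Rightarrow>
     real \<Rightarrow> nat \<Rightarrow> ('x \<Rightarrow> real) \<Rightarrow> real" where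
  "success_prob D S A \<epsilon> m t =
     measure (run_space D S)
       {(w, xs) \<in> space (run_space D S).
          \<exists>g. sq_output A t w xs m [] = Some g \<and> approximates D \<epsilon> t g}"

end

theory Submission
  imports Defs
begin

text \<open>
  Let \<open>h 1, \<dots>, h d\<close> be a family as in the definition of the dimension.  Its pairwise correlations
  are nearly equal, so by a Bessel-type inequality the squared deviations of
  \<open>corr D g (h i)\<close> from their mean over \<open>i\<close> sum to at most 3, for every query \<open>g\<close>.  Compare the
  run on target \<open>h i\<close> with a run whose responses have the mean correlation instead.  The latter does
  not depend on \<open>i\<close>, and its output approximates at most one \<open>h i\<close>.  Summed over \<open>i\<close>, each query
  increases the total success probability by at most \<open>sqrt (3 * d) / 2\<close>, so
  \<open>2 / 3 * d \<le> 1 + m * sqrt (3 * d) / 2\<close>, which is stronger than the cube root bound.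
\<close>

section \<open>Sign-valued functions and their correlations\<close>

lemma sign_valued:
  assumes "f \<in> M \<rightarrow>\<^sub>M count_space {-1, 1::real}"
  shows "f \<in> borel_measurable M" and "\<And>x. x \<in> space M \<Longrightarrow> f x = -1 \<or> f x = 1"
proof -
  show "f \<in> borel_measurable M"
    using measurable_compose[OF assms, of "\<lambda>x. x" borel] by simp
  show "\<And>x. x \<in> space M \<Longrightarrow> f x = -1 \<or> f x = 1"
    using measurable_space[OF assms] by auto
qed

lemma (in prob_space) integrable_sign_product:
  assumes "f \<in> M \<rightarrow>\<^sub>M count_space {-1, 1::real}" and "g \<in> M \<rightarrow>\<^sub>M count_space {-1, 1::real}"
  shows "integrable M (\<lambda>x. f x * g x)"
proof (rule integrable_const_bound[where B = 1])
  show "AE x in M. norm (f x * g x) \<le> 1"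
  proof (intro AE_I2)
    fix x assume "x \<in> space M"
    then show "norm (f x * g x) \<le> 1"
      using sign_valued(2)[OF assms(1), of x] sign_valued(2)[OF assms(2), of x] by auto
  qed
qed (use sign_valued(1)[OF assms(1)] sign_valued(1)[OF assms(2)] in measurable)

lemma corr_commute: "corr D f g = corr D g f"
  by (simp add: corr_def mult.commute)

lemma (in prob_space) corr_self:
  assumes "f \<in> M \<rightarrow>\<^sub>M count_space {-1, 1::real}"
  shows "corr M f f = 1"
proof -
  have "corr M f f = (\<integral>x. 1 \<partial>M)"
    unfolding corr_def
    by (intro Bochner_Integration.integral_cong) (auto dest: sign_valued(2)[OF assms])
  then show ?thesis by (simp add: prob_space)
qed

lemma (in prob_space) abs_corr_le_1:
  assumes "f \<in> M \<rightarrow>\<^sub>M count_space {-1, 1::real}" and "g \<in> M \<rightarrow>\<^sub>M count_space {-1, 1::real}"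
  shows "\<bar>corr M f g\<bar> \<le> 1"
proof -
  have "\<bar>corr M f g\<bar> \<le> (\<integral>x. \<bar>f x * g x\<bar> \<partial>M)"
    unfolding corr_def by (rule integral_abs_bound)
  also have "\<dots> = (\<integral>x. 1 \<partial>M)"
  proof (intro Bochner_Integration.integral_cong)
    fix x assume "x \<in> space M"
    then show "\<bar>f x * g x\<bar> = 1"
      using sign_valued(2)[OF assms(1), of x] sign_valued(2)[OF assms(2), of x] by auto
  qed simp
  finally show ?thesis by (simp add: prob_space)
qed

text \<open>For signs, the indicator of \<open>f x * g x = r\<close> is affine in
  \<open>f x * g x\<close>. Hence the law of an oracle response depends on query and target only
  through their correlation.\<close>

lemma (in prob_space) prob_sign_product:
  assumes "f \<in> M \<rightarrow>\<^sub>M count_space {-1, 1::real}" and "g \<in> M \<rightarrow>\<^sub>M count_space {-1, 1::real}"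
    and "r \<in> {-1, 1}"
  shows "prob {x \<in> space M. f x * g x = r} = (1 + r * corr M f g) / 2"
proof -
  have [measurable]: "f \<in> borel_measurable M" "g \<in> borel_measurable M"
    by (rule sign_valued(1)[OF assms(1)], rule sign_valued(1)[OF assms(2)])
  have pointwise: "indicator {x \<in> space M. f x * g x = r} x = (1 + r * (f x * g x)) / 2"
    if "x \<in> space M" for x
  proof -
    have "f x = -1 \<or> f x = 1" "g x = -1 \<or> g x = 1"
      using sign_valued(2)[OF assms(1) that] sign_valued(2)[OF assms(2) that] .
    then show ?thesis using that assms(3) by (auto simp: indicator_def)
  qed
  have "prob {x \<in> space M. f x * g x = r} = (\<integral>x. indicator {x \<in> space M. f x * g x = r} x \<partial>M)"
    by simp
  also have "\<dots> = (\<integral>x. (1 + r * (f x * g x)) / 2 \<partial>M)"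
    by (intro Bochner_Integration.integral_cong) (auto simp: pointwise)
  also have "\<dots> = (1 + r * corr M f g) / 2"
    using integrable_sign_product[OF assms(1,2)] by (simp add: corr_def prob_space)
  finally show ?thesis .
qed

text \<open>
  Two functions that agree with \<open>g\<close> up to probability less than \<open>\<epsilon> / 2\<close> disagree with
  probability less than \<open>\<epsilon>\<close>; pointwise, this is \<open>f * g + g * h \<le> 1 + f * h\<close> for signs.
\<close>

lemma (in prob_space) approximates_imp_corr:
  assumes "f \<in> M \<rightarrow>\<^sub>M count_space {-1, 1::real}" and "g \<in> M \<rightarrow>\<^sub>M count_space {-1, 1::real}"
    and "h \<in> M \<rightarrow>\<^sub>M count_space {-1, 1::real}"
    and "approximates M \<epsilon> f g" and "approximates M \<epsilon> h g"
  shows "corr M f h > 1 - 2 * \<epsilon>"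
proof -
  have "corr M g f + corr M g h = (\<integral>x. g x * f x + g x * h x \<partial>M)"
    unfolding corr_def using assms by (simp add: integrable_sign_product)
  also have "\<dots> \<le> (\<integral>x. 1 + f x * h x \<partial>M)"
  proof (rule integral_mono)
    fix x assume "x \<in> space M"
    then have "f x = -1 \<or> f x = 1" "g x = -1 \<or> g x = 1" "h x = -1 \<or> h x = 1"
      using assms(1-3)[THEN sign_valued(2)] by simp_all
    then show "g x * f x + g x * h x \<le> 1 + f x * h x" by auto
  qed (use assms in \<open>simp_all add: integrable_sign_product\<close>)
  also have "\<dots> = 1 + corr M f h"
    unfolding corr_def using assms by (simp add: integrable_sign_product prob_space)
  finally show ?thesis
    using assms(4,5) unfolding approximates_def by simp
qed

section \<open>Correlations with a nearly equicorrelated family\<close>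

text \<open>This is Cauchy-Schwarz in L2 for the combination of the \<open>h i\<close> with
  coefficients \<open>a i\<close>, paired with \<open>g\<close>, which has unit norm because its
  values are signs.\<close>

lemma (in prob_space) corr_Cauchy_Schwarz:
  assumes "finite I" and g: "g \<in> M \<rightarrow>\<^sub>M count_space {-1, 1::real}"
    and h: "\<And>i. i \<in> I \<Longrightarrow> h i \<in> M \<rightarrow>\<^sub>M count_space {-1, 1::real}"
  shows "(\<Sum>i\<in>I. a i * corr M g (h i))\<^sup>2 \<le> (\<Sum>i\<in>I. \<Sum>j\<in>I. a i * a j * corr M (h i) (h j))"
proof -
  define c where "c = (\<Sum>i\<in>I. a i * corr M g (h i))"
  define Z where "Z x = (\<Sum>i\<in>I. a i * h i x)" for x
  have Zg: "Z x * g x = (\<Sum>i\<in>I. a i * (g x * h i x))" for x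
    unfolding Z_def sum_distrib_right by (simp add: ac_simps)
  have ZZ: "Z x * Z x = (\<Sum>i\<in>I. \<Sum>j\<in>I. a i * a j * (h i x * h j x))" for x
    unfolding Z_def sum_product by (simp add: ac_simps)
  have int: "integrable M (\<lambda>x. Z x * g x)" "integrable M (\<lambda>x. Z x * Z x)"
    unfolding Zg ZZ using g h
    by (auto intro!: Bochner_Integration.integrable_sum integrable_mult_right integrable_sign_product)
  have EZg: "(\<integral>x. Z x * g x \<partial>M) = c"
    unfolding Zg c_def corr_def using g h
    by (subst Bochner_Integration.integral_sum) (auto intro!: integrable_mult_right integrable_sign_product)
  have EZZ: "(\<integral>x. Z x * Z x \<partial>M) = (\<Sum>i\<in>I. \<Sum>j\<in>I. a i * a j * corr M (h i) (h j))"
    unfolding ZZ corr_def using g h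
    by (subst Bochner_Integration.integral_sum,
        auto intro!: Bochner_Integration.integrable_sum integrable_mult_right integrable_sign_product sum.cong)
      (subst Bochner_Integration.integral_sum,
        auto intro!: integrable_mult_right integrable_sign_product sum.cong)
  \<comment> \<open>\<open>c * g\<close> is the orthogonal projection of \<open>Z\<close> onto
    \<open>g\<close>, so expanding the square leaves the second moment of \<open>Z\<close> minus
    \<open>c\<^sup>2\<close>.\<close>
  have "0 \<le> (\<integral>x. (Z x - c * g x)\<^sup>2 \<partial>M)" by simp
  also have "\<dots> = (\<integral>x. Z x * Z x - 2 * c * (Z x * g x) + c\<^sup>2 * (g x * g x) \<partial>M)"
    by (simp add: power2_eq_square algebra_simps)
  also have "\<dots> = (\<integral>x. Z x * Z x \<partial>M) - 2 * c * c + c\<^sup>2 * corr M g g"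
    unfolding corr_def using int integrable_sign_product[OF g g] by (simp add: EZg)
  finally show ?thesis
    unfolding EZZ corr_self[OF g] c_def[symmetric] by (simp add: power2_eq_square)
qed

text \<open>
  The deviations \<open>a i\<close> of the correlations from their mean sum to zero, so shifting all pairwise
  correlations by \<open>\<rho>\<close> does not change the quadratic form in \<open>a\<close> that bounds
  \<open>(\<Sum>i\<in>I. (a i)\<^sup>2)\<^sup>2\<close>.
\<close>

lemma (in prob_space) sum_corr_deviation_le:
  fixes h :: "'i \<Rightarrow> 'a \<Rightarrow> real"
  defines "mean \<equiv> \<lambda>I g. (\<Sum>i\<in>I. corr M g (h i)) / real (card I)"
  assumes I: "finite I" "I \<noteq> {}" and g: "g \<in> M \<rightarrow>\<^sub>M count_space {-1, 1::real}"
    and h: "\<And>i. i \<in> I \<Longrightarrow> h i \<in> M \<rightarrow>\<^sub>M count_space {-1, 1::real}"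
    and \<rho>: "\<bar>\<rho>\<bar> \<le> 1"
    and near: "\<And>i j. i \<in> I \<Longrightarrow> j \<in> I \<Longrightarrow> i \<noteq> j \<Longrightarrow> \<bar>corr M (h i) (h j) - \<rho>\<bar> \<le> 1 / real (card I)"
  shows "(\<Sum>i\<in>I. \<bar>corr M g (h i) - mean I g\<bar>) \<le> sqrt (3 * real (card I))"
proof -
  define d where "d = real (card I)"
  define a where "a i = corr M g (h i) - mean I g" for i
  define s where "s = (\<Sum>i\<in>I. (a i)\<^sup>2)"
  have d: "d > 0" using I by (simp add: d_def card_gt_0_iff)
  have s0: "s \<ge> 0" by (simp add: s_def sum_nonneg)
  have sum_a: "(\<Sum>i\<in>I. a i) = 0"
    using d by (simp add: a_def sum_subtractf mean_def d_def)
  have abs_a: "(\<Sum>i\<in>I. \<bar>a i\<bar>)\<^sup>2 \<le> s * d"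
    using sum_squared_le_sum_of_squares[of "\<lambda>i. \<bar>a i\<bar>" I] I by (simp add: s_def d_def)
  \<comment> \<open>The constant \<open>mean I g\<close> is orthogonal to the deviations, so taking
    the deviations as coefficients turns the left side of Cauchy-Schwarz into
    \<open>s\<^sup>2\<close>.\<close>
  have "(\<Sum>i\<in>I. a i * corr M g (h i)) = (\<Sum>i\<in>I. (a i)\<^sup>2 + mean I g * a i)"
    by (intro sum.cong) (auto simp: a_def power2_eq_square algebra_simps)
  also have "\<dots> = s"
    by (simp add: sum.distrib sum_distrib_left[symmetric] sum_a s_def)
  finally have "s\<^sup>2 \<le> (\<Sum>i\<in>I. \<Sum>j\<in>I. a i * a j * corr M (h i) (h j))"
    using corr_Cauchy_Schwarz[OF I(1) g, of h a] h by simp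
  also have "\<dots> = (\<Sum>i\<in>I. \<Sum>j\<in>I. a i * a j * (corr M (h i) (h j) - \<rho>)) + \<rho> * ((\<Sum>i\<in>I. a i) * (\<Sum>j\<in>I. a j))"
    unfolding sum_product by (simp add: sum_distrib_left sum.distrib[symmetric] algebra_simps)
  also have "\<dots> = (\<Sum>i\<in>I. \<Sum>j\<in>I. a i * a j * (corr M (h i) (h j) - \<rho>))"
    by (simp add: sum_a)
  \<comment> \<open>Self-correlations are 1 and need not be close to \<rho>; the second term pays
    for them with \<open>1 - \<rho> \<le> 2\<close>. The first term is kept on the diagonal too, so
    that its double sum is a full square.\<close>
  also have "\<dots> \<le> (\<Sum>i\<in>I. \<Sum>j\<in>I. \<bar>a i\<bar> * \<bar>a j\<bar> / d + (if i = j then 2 * (a i)\<^sup>2 else 0))"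
  proof (intro sum_mono)
    fix i j assume ij: "i \<in> I" "j \<in> I"
    show "a i * a j * (corr M (h i) (h j) - \<rho>) \<le> \<bar>a i\<bar> * \<bar>a j\<bar> / d + (if i = j then 2 * (a i)\<^sup>2 else 0)"
    proof (cases "i = j")
      case True
      have "(a i)\<^sup>2 * (1 - \<rho>) \<le> (a i)\<^sup>2 * 2"
        using \<rho> by (intro mult_left_mono) auto
      moreover have "\<bar>a i\<bar> * \<bar>a i\<bar> / d \<ge> 0" using d by simp
      ultimately show ?thesis
        using True corr_self[OF h[OF ij(1)]] by (simp add: power2_eq_square)
    next
      case False
      have "a i * a j * (corr M (h i) (h j) - \<rho>) \<le> \<bar>a i * a j\<bar> * \<bar>corr M (h i) (h j) - \<rho>\<bar>"
        by (metis abs_ge_self abs_mult)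
      also have "\<dots> \<le> \<bar>a i * a j\<bar> * (1 / d)"
        using near[OF ij False] by (intro mult_left_mono) (auto simp: d_def)
      finally show ?thesis using False by (simp add: abs_mult)
    qed
  qed
  also have "\<dots> = (\<Sum>i\<in>I. \<bar>a i\<bar>)\<^sup>2 / d + 2 * s"
    unfolding power2_eq_square[of "\<Sum>i\<in>I. \<bar>a i\<bar>"] sum_product
    using I(1) by (simp add: sum.distrib sum_divide_distrib s_def sum_distrib_left)
  \<comment> \<open>The tolerance \<open>1 / d\<close> cancels the factor \<open>d\<close> lost in
    \<open>abs_a\<close> between the l1 and l2 norms.\<close>
  also have "\<dots> \<le> s + 2 * s"
    using abs_a d by (simp add: divide_le_eq)
  finally have "s * s \<le> 3 * s" by (simp add: power2_eq_square)
  then have "s \<le> 3"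
    using s0 by (cases "s = 0") auto
  then have "(\<Sum>i\<in>I. \<bar>a i\<bar>)\<^sup>2 \<le> 3 * d"
    using abs_a d by (meson mult_right_mono order_trans less_imp_le)
  then show ?thesis
    unfolding a_def d_def by (intro real_le_rsqrt) simp
qed

section \<open>Success probability as a recursion over responses\<close>

text \<open>For a fixed seed, this is the conditional probability of success given the responses
  \<open>rs\<close>, with at most \<open>n\<close> further queries. No samples appear:
  \<open>(1 + r * corr D h t) / 2\<close> is the probability of the response \<open>r\<close>, so
  runs on different targets can be compared branch by branch.\<close>

fun success_weight :: "'x measure \<Rightarrow> real \<Rightarrow> ('x \<Rightarrow> real) \<Rightarrow> (real list \<Rightarrow> ('x \<Rightarrow> real) action) \<Rightarrow>
    nat \<Rightarrow> real list \<Rightarrow> real" where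
  "success_weight D \<epsilon> t a 0 rs =
     (case a rs of Output g \<Rightarrow> of_bool (approximates D \<epsilon> t g) | Query h \<Rightarrow> 0)"
| "success_weight D \<epsilon> t a (Suc n) rs =
     (case a rs of
        Output g \<Rightarrow> of_bool (approximates D \<epsilon> t g)
      | Query h \<Rightarrow> \<Sum>r\<in>{-1, 1}. (1 + r * corr D h t) / 2 * success_weight D \<epsilon> t a n (rs @ [r]))"

lemma (in prob_space) success_weight_bounds:
  assumes a: "\<And>rs. set rs \<subseteq> {-1, 1} \<Longrightarrow> hyp (a rs) \<in> M \<rightarrow>\<^sub>M count_space {-1, 1::real}"
    and t: "t \<in> M \<rightarrow>\<^sub>M count_space {-1, 1::real}"
    and "set rs \<subseteq> {-1, 1}"
  shows "0 \<le> success_weight M \<epsilon> t a n rs \<and> success_weight M \<epsilon> t a n rs \<le> 1"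
  using assms(3)
proof (induction n arbitrary: rs)
  case 0
  then show ?case by (simp split: action.split)
next
  case (Suc n)
  show ?case
  proof (cases "a rs")
    case (Query h)
    have c: "\<bar>corr M h t\<bar> \<le> 1"
      using abs_corr_le_1[OF a[OF Suc.prems] t] Query by simp
    have IH: "0 \<le> success_weight M \<epsilon> t a n (rs @ [r])" "success_weight M \<epsilon> t a n (rs @ [r]) \<le> 1"
      if "r \<in> {-1, 1}" for r
      using Suc.IH[of "rs @ [r]"] Suc.prems that by auto
    have "(1 - corr M h t) / 2 * success_weight M \<epsilon> t a n (rs @ [-1]) \<le> (1 - corr M h t) / 2 * 1"
      "(1 + corr M h t) / 2 * success_weight M \<epsilon> t a n (rs @ [1]) \<le> (1 + corr M h t) / 2 * 1"
      using c IH(2) by (intro mult_left_mono; simp)+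
    moreover have "0 \<le> (1 - corr M h t) / 2 * success_weight M \<epsilon> t a n (rs @ [-1])"
      "0 \<le> (1 + corr M h t) / 2 * success_weight M \<epsilon> t a n (rs @ [1])"
      using c IH(1) by (intro mult_nonneg_nonneg; simp)+
    ultimately show ?thesis using Query by (simp add: field_simps)
  qed simp
qed

text \<open>
  Against the reference oracle whose response to \<open>g\<close> has mean \<open>q g\<close>, the output does not depend
  on the target, hence is correct for at most one \<open>i\<close>.  Replacing one reference response by
  the true one changes the success probability for \<open>h i\<close> by at most
  \<open>\<bar>corr M g (h i) - q g\<bar> / 2\<close>.
\<close>

lemma (in prob_space) sum_success_weight_le:
  fixes h :: "'i \<Rightarrow> 'a \<Rightarrow> real"
  assumes I: "finite I"
    and h: "\<And>i. i \<in> I \<Longrightarrow> h i \<in> M \<rightarrow>\<^sub>M count_space {-1, 1::real}"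
    and a: "\<And>rs. set rs \<subseteq> {-1, 1} \<Longrightarrow> hyp (a rs) \<in> M \<rightarrow>\<^sub>M count_space {-1, 1::real}"
    and unique: "\<And>g i j. g \<in> M \<rightarrow>\<^sub>M count_space {-1, 1::real} \<Longrightarrow> i \<in> I \<Longrightarrow> j \<in> I \<Longrightarrow>
      approximates M \<epsilon> (h i) g \<Longrightarrow> approximates M \<epsilon> (h j) g \<Longrightarrow> i = j"
    and q: "\<And>g. g \<in> M \<rightarrow>\<^sub>M count_space {-1, 1::real} \<Longrightarrow> \<bar>q g\<bar> \<le> 1"
    and dev: "\<And>g. g \<in> M \<rightarrow>\<^sub>M count_space {-1, 1::real} \<Longrightarrow> (\<Sum>i\<in>I. \<bar>corr M g (h i) - q g\<bar>) \<le> 2 * B"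
    and "set rs \<subseteq> {-1, 1}" and B: "B \<ge> 0"
  shows "(\<Sum>i\<in>I. success_weight M \<epsilon> (h i) a n rs) \<le> 1 + real n * B"
proof -
  have outputs: "(\<Sum>i\<in>I. of_bool (approximates M \<epsilon> (h i) g)) \<le> (1 :: real)"
    if "set rs \<subseteq> {-1, 1}" "a rs = Output g" for rs g
  proof -
    have g: "g \<in> M \<rightarrow>\<^sub>M count_space {-1, 1::real}" using a[OF that(1)] that(2) by simp
    have "card {i \<in> I. approximates M \<epsilon> (h i) g} \<le> 1"
      using I unique[OF g] by (intro card_le_Suc0_iff_eq[THEN iffD2, simplified One_nat_def[symmetric]]) auto
    then show ?thesis using I by (simp add: Int_def conj_commute)
  qed
  show ?thesis
    using \<open>set rs \<subseteq> {-1, 1}\<close>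
  proof (induction n arbitrary: rs)
    case 0
    then show ?case using outputs B by (cases "a rs") auto
  next
    case (Suc n)
    show ?case
    proof (cases "a rs")
      case (Output g)
      have "1 \<le> 1 + real (Suc n) * B" using B by simp
      then show ?thesis using outputs[OF Suc.prems Output] Output by simp
    next
      case (Query g)
      define W where "W i r = success_weight M \<epsilon> (h i) a n (rs @ [r])" for i r
      have g: "g \<in> M \<rightarrow>\<^sub>M count_space {-1, 1::real}"
        using a[OF Suc.prems] Query by simp
      have W: "0 \<le> W i r" "W i r \<le> 1" if "i \<in> I" "r \<in> {-1, 1}" for i r
        using success_weight_bounds[OF a h[OF that(1)], of _ "rs @ [r]" \<epsilon> n] Suc.prems that(2)
        by (auto simp: W_def)
      have IH: "(\<Sum>i\<in>I. W i r) \<le> 1 + real n * B" if "r \<in> {-1, 1}" for r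
        unfolding W_def using Suc.IH[of "rs @ [r]"] Suc.prems that by auto
      \<comment> \<open>The two averages differ by
        \<open>(corr M g (h i) - q g) * (W i 1 - W i (-1)) / 2\<close>, where the second factor is
        at most 1 in absolute value.\<close>
      have step: "(1 - corr M g (h i)) / 2 * W i (-1) + (1 + corr M g (h i)) / 2 * W i 1
        \<le> (1 - q g) / 2 * W i (-1) + (1 + q g) / 2 * W i 1 + \<bar>corr M g (h i) - q g\<bar> / 2"
        if "i \<in> I" for i
      proof -
        have "(corr M g (h i) - q g) * (W i 1 - W i (-1)) \<le> \<bar>corr M g (h i) - q g\<bar> * \<bar>W i 1 - W i (-1)\<bar>"
          by (metis abs_ge_self abs_mult)
        also have "\<dots> \<le> \<bar>corr M g (h i) - q g\<bar> * 1"
          using W[OF that, of 1] W[OF that, of "-1"] by (intro mult_left_mono) auto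
        finally show ?thesis by (simp add: field_simps)
      qed
      have "(\<Sum>i\<in>I. success_weight M \<epsilon> (h i) a (Suc n) rs)
        = (\<Sum>i\<in>I. (1 - corr M g (h i)) / 2 * W i (-1) + (1 + corr M g (h i)) / 2 * W i 1)"
        using Query by (simp add: W_def)
      also have "\<dots> \<le> (\<Sum>i\<in>I. (1 - q g) / 2 * W i (-1) + (1 + q g) / 2 * W i 1
          + \<bar>corr M g (h i) - q g\<bar> / 2)"
        by (intro sum_mono step)
      \<comment> \<open>The reference probabilities are the same for all \<open>i\<close>, so they
        leave the sum and the induction hypothesis applies to each branch. They add up to 1, so the
        query costs only \<open>B\<close>.\<close>
      also have "\<dots> = (1 - q g) / 2 * (\<Sum>i\<in>I. W i (-1)) + (1 + q g) / 2 * (\<Sum>i\<in>I. W i 1)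
          + (\<Sum>i\<in>I. \<bar>corr M g (h i) - q g\<bar>) / 2"
        by (simp add: sum.distrib sum_distrib_left sum_divide_distrib)
      also have "\<dots> \<le> (1 - q g) / 2 * (1 + real n * B) + (1 + q g) / 2 * (1 + real n * B) + 2 * B / 2"
        using q[OF g] dev[OF g] IH by (intro add_mono mult_left_mono divide_right_mono) auto
      also have "\<dots> = 1 + real (Suc n) * B" by (simp add: field_simps)
      finally show ?thesis .
    qed
  qed
qed

section \<open>Runs on independent samples\<close>

lemma (in prob_space) cylinder_prob:
  fixes B :: "nat \<Rightarrow> 'a set"
  defines "P \<equiv> (\<Pi>\<^sub>M k\<in>UNIV. M)"
  assumes "\<And>i. i < k \<Longrightarrow> B i \<in> sets M"
  shows "{xs \<in> space P. \<forall>i<k. xs i \<in> B i} \<in> sets P"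
    and "measure P {xs \<in> space P. \<forall>i<k. xs i \<in> B i} = (\<Prod>i<k. prob (B i))"
proof -
  interpret P: product_prob_space "\<lambda>_. M" "UNIV :: nat set" ..
  have "{xs \<in> space P. \<forall>i<k. xs i \<in> B i} = prod_emb UNIV (\<lambda>_. M) {..<k} (Pi\<^sub>E {..<k} B)"
    by (auto simp: P_def prod_emb_def space_PiM PiE_iff)
  then show "measure P {xs \<in> space P. \<forall>i<k. xs i \<in> B i} = (\<Prod>i<k. prob (B i))"
    "{xs \<in> space P. \<forall>i<k. xs i \<in> B i} \<in> sets P"
    using P.measure_PiM_emb[of "{..<k}" B] assms by (auto simp: P_def intro!: sets_PiM_I)
qed

text \<open>For the induction on \<open>n\<close>, the samples already consumed are confined to
  arbitrary sets \<open>B i\<close>. These sets and \<open>rs\<close> need not be related: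
  \<open>sq_output\<close> reads only samples with index at least \<open>length rs\<close>, which
  are independent of the earlier ones.\<close>

lemma (in prob_space) measure_successful_runs:
  fixes A :: "'w \<Rightarrow> real list \<Rightarrow> ('a \<Rightarrow> real) action" and B :: "nat \<Rightarrow> 'a set"
  defines "P \<equiv> (\<Pi>\<^sub>M k\<in>UNIV. M)"
  defines "E \<equiv> \<lambda>\<epsilon> t w n rs B. {xs \<in> space P. (\<forall>i<length rs. xs i \<in> B i) \<and>
      (\<exists>g. sq_output A t w xs n rs = Some g \<and> approximates M \<epsilon> t g)}"
  assumes a: "\<And>rs. set rs \<subseteq> {-1, 1} \<Longrightarrow> hyp (A w rs) \<in> M \<rightarrow>\<^sub>M count_space {-1, 1::real}"
    and t: "t \<in> M \<rightarrow>\<^sub>M count_space {-1, 1::real}"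
    and "set rs \<subseteq> {-1, 1}" and "\<And>i. i < length rs \<Longrightarrow> B i \<in> sets M"
  shows "E \<epsilon> t w n rs B \<in> sets P \<and>
    measure P (E \<epsilon> t w n rs B) = (\<Prod>i<length rs. prob (B i)) * success_weight M \<epsilon> t (A w) n rs"
  using assms(5,6)
proof (induction n arbitrary: rs B)
  case 0
  then show ?case
    using cylinder_prob[of "length rs" B]
    by (cases "A w rs") (auto simp: E_def P_def)
next
  case (Suc n)
  interpret P: prob_space P
    unfolding P_def by (intro prob_space_PiM prob_space_axioms)
  show ?case
  proof (cases "A w rs")
    case (Output g)
    then show ?thesis
      using cylinder_prob[of "length rs" B] Suc.prems by (auto simp: E_def P_def)
  next
    case (Query h)
    define k where "k = length rs"
    define C where "C r = {x \<in> space M. h x * t x = r}" for r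
    \<comment> \<open>The response \<open>r\<close> becomes the constraint \<open>C r\<close> on
      sample \<open>k\<close>, the one read by the current query; the rest of the run is then an
      instance of the induction hypothesis.\<close>
    define F where "F r = E \<epsilon> t w n (rs @ [r]) (B(k := C r))" for r
    have h: "h \<in> M \<rightarrow>\<^sub>M count_space {-1, 1::real}"
      using a[OF Suc.prems(1)] Query by simp
    have [measurable]: "h \<in> borel_measurable M" "t \<in> borel_measurable M"
      by (rule sign_valued(1)[OF h], rule sign_valued(1)[OF t])
    have C: "C r \<in> sets M" for r unfolding C_def by measurable
    have IH: "F r \<in> sets P" "measure P (F r) =
      (\<Prod>i<k. prob (B i)) * ((1 + r * corr M h t) / 2) * success_weight M \<epsilon> t (A w) n (rs @ [r])"
      if "r \<in> {-1, 1}" for r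
    proof -
      have "F r \<in> sets P \<and> measure P (F r) = (\<Prod>i<length (rs @ [r]). prob ((B(k := C r)) i)) *
          success_weight M \<epsilon> t (A w) n (rs @ [r])"
        unfolding F_def using that Suc.prems C by (intro Suc.IH) (auto simp: k_def less_Suc_eq)
      moreover have "(\<Prod>i<length (rs @ [r]). prob ((B(k := C r)) i)) = (\<Prod>i<k. prob (B i)) * prob (C r)"
        by (simp add: k_def)
      ultimately show "F r \<in> sets P" "measure P (F r) =
          (\<Prod>i<k. prob (B i)) * ((1 + r * corr M h t) / 2) * success_weight M \<epsilon> t (A w) n (rs @ [r])"
        using prob_sign_product[OF h t that] by (auto simp: C_def)
    qed
    \<comment> \<open>Every point of \<open>space M\<close> gives a response in
      \<open>{-1, 1}\<close>, so the event splits by the response.\<close>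
    have "E \<epsilon> t w (Suc n) rs B = F (-1) \<union> F 1"
    proof (intro set_eqI)
      fix xs
      show "xs \<in> E \<epsilon> t w (Suc n) rs B \<longleftrightarrow> xs \<in> F (-1) \<union> F 1"
      proof (cases "xs \<in> space P")
        case True
        then have x: "xs k \<in> space M" by (auto simp: P_def space_PiM)
        then have "h (xs k) * t (xs k) \<in> {-1, 1}"
          using sign_valued(2)[OF h x] sign_valued(2)[OF t x] by auto
        then show ?thesis
          using True x Query by (auto simp: F_def E_def C_def k_def less_Suc_eq)
      qed (simp add: E_def F_def)
    qed
    moreover have "F (-1) \<inter> F 1 = {}"
      by (auto simp: F_def E_def C_def k_def)
    ultimately show ?thesis
      using Query by (simp add: P.finite_measure_Union IH sets.Un) (simp add: k_def algebra_simps)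
  qed
qed

text \<open>Fubini over the seed: each slice of the success event has measure
  \<open>success_weight\<close>. Positivity makes the event measurable, and measurability of the
  weight in the seed follows from that of the slice measures.\<close>

lemma (in prob_space) success_prob_eq:
  fixes A :: "'w \<Rightarrow> real list \<Rightarrow> ('a \<Rightarrow> real) action"
  assumes S: "prob_space S"
    and A: "\<And>w rs. w \<in> space S \<Longrightarrow> set rs \<subseteq> {-1, 1} \<Longrightarrow>
      hyp (A w rs) \<in> M \<rightarrow>\<^sub>M count_space {-1, 1::real}"
    and t: "t \<in> M \<rightarrow>\<^sub>M count_space {-1, 1::real}"
    and pos: "success_prob M S A \<epsilon> m t > 0"
  shows "integrable S (\<lambda>w. success_weight M \<epsilon> t (A w) m [])"
    and "success_prob M S A \<epsilon> m t = (\<integral>w. success_weight M \<epsilon> t (A w) m [] \<partial>S)"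
proof -
  define P where "P = (\<Pi>\<^sub>M k\<in>(UNIV :: nat set). M)"
  define Q where "Q = {(w, xs) \<in> space (S \<Otimes>\<^sub>M P).
    \<exists>g. sq_output A t w xs m [] = Some g \<and> approximates M \<epsilon> t g}"
  let ?f = "\<lambda>w. success_weight M \<epsilon> t (A w) m []"
  interpret S: prob_space S by fact
  interpret P: prob_space P
    unfolding P_def by (intro prob_space_PiM prob_space_axioms)
  have prob_Q: "success_prob M S A \<epsilon> m t = measure (S \<Otimes>\<^sub>M P) Q"
    by (simp add: success_prob_def run_space_def P_def Q_def)
  \<comment> \<open>The measure of a non-measurable set is 0.\<close>
  then have Q: "Q \<in> sets (S \<Otimes>\<^sub>M P)"
    using pos measure_notin_sets by fastforce
  have slice: "emeasure P (Pair w -` Q) = ennreal (?f w)" if w: "w \<in> space S" for w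
  proof -
    have "Pair w -` Q = {xs \<in> space P. \<exists>g. sq_output A t w xs m [] = Some g \<and> approximates M \<epsilon> t g}"
      using w by (auto simp: Q_def space_pair_measure)
    then show ?thesis
      using measure_successful_runs[of A w t "[]" "\<lambda>_. {}" m \<epsilon>] A[OF w] t
      by (simp add: P_def[symmetric] P.emeasure_eq_measure)
  qed
  have bounds: "0 \<le> ?f w" "?f w \<le> 1" if "w \<in> space S" for w
    using success_weight_bounds[of "A w" t "[]" \<epsilon> m] A[OF that] t by auto
  have "(\<lambda>w. enn2real (emeasure P (Pair w -` Q))) \<in> borel_measurable S"
    using P.measurable_emeasure_Pair[OF Q] by measurable
  then have f: "?f \<in> borel_measurable S"
    by (rule measurable_cong[THEN iffD1, rotated]) (simp add: slice bounds)
  show int: "integrable S ?f"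
    using f bounds by (intro S.integrable_const_bound[where B = 1]) auto
  have "emeasure (S \<Otimes>\<^sub>M P) Q = (\<integral>\<^sup>+ w. ennreal (?f w) \<partial>S)"
    unfolding P.emeasure_pair_measure_alt[OF Q] by (intro nn_integral_cong slice)
  also have "\<dots> = ennreal (\<integral>w. ?f w \<partial>S)"
    using int bounds by (intro nn_integral_eq_integral) auto
  finally show "success_prob M S A \<epsilon> m t = (\<integral>w. ?f w \<partial>S)"
    unfolding prob_Q measure_def using bounds by (simp add: integral_nonneg_AE)
qed

section \<open>The query bound for a single family\<close>

text \<open>Fixing the seed makes the algorithm deterministic, and
  \<open>sum_success_weight_le\<close> bounds the total success over all targets for that seed.
  Averaging over \<open>S\<close> covers randomized algorithms.\<close>

lemma (in prob_space) strong_SQ_family_success_bound: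
  assumes H: "hypothesis_class M H"
    and d: "d \<ge> 2" and fam: "strong_SQ_family M H (2 * \<epsilon>) d h"
    and alg: "sq_algorithm M H S A"
    and succ: "\<And>t. t \<in> H \<Longrightarrow> success_prob M S A \<epsilon> m t \<ge> p" and p: "p > 0"
  shows "real d * p \<le> 1 + real m * (sqrt (3 * real d) / 2)"
proof -
  define I where "I = {1..d}"
  define B where "B = sqrt (3 * real d) / 2"
  define q where "q g = (\<Sum>i\<in>I. corr M g (h i)) / real (card I)" for g
  have I: "finite I" "I \<noteq> {}" "card I = d" using d by (auto simp: I_def)
  interpret S: prob_space S using alg by (simp add: sq_algorithm_def)
  have hH: "h i \<in> H" if "i \<in> I" for i
    using fam that by (simp add: strong_SQ_family_def I_def)
  have hyp: "g \<in> M \<rightarrow>\<^sub>M count_space {-1, 1}" if "g \<in> H" for g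
    using H that by (auto simp: hypothesis_class_def)
  note h = hyp[OF hH]
  have A: "hyp (A w rs) \<in> M \<rightarrow>\<^sub>M count_space {-1, 1}"
    if "w \<in> space S" "set rs \<subseteq> {-1, 1}" for w rs
    using alg that by (auto simp: sq_algorithm_def intro: hyp)
  \<comment> \<open>The correlation of the first pair serves as the common value \<rho>; the pair
    exists since \<open>d \<ge> 2\<close>.\<close>
  have near: "\<bar>corr M (h i) (h j) - corr M (h 1) (h 2)\<bar> \<le> 1 / real (card I)"
    if "i \<in> I" "j \<in> I" "i \<noteq> j" for i j
  proof -
    have *: "\<bar>corr M (h i) (h j) - corr M (h 1) (h 2)\<bar> \<le> 1 / real d"
      if "1 \<le> i" "i < j" "j \<le> d" for i j
      using fam d that unfolding strong_SQ_family_def by auto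
    show ?thesis
      using *[of i j] *[of j i] that unfolding I(3) by (cases "i < j") (auto simp: corr_commute I_def)
  qed
  have dev: "(\<Sum>i\<in>I. \<bar>corr M g (h i) - q g\<bar>) \<le> 2 * B"
    if "g \<in> M \<rightarrow>\<^sub>M count_space {-1, 1}" for g
  proof -
    have "\<bar>corr M (h 1) (h 2)\<bar> \<le> 1"
      using d by (intro abs_corr_le_1 h) (auto simp: I_def)
    then show ?thesis
      using sum_corr_deviation_le[OF I(1,2) that h _ near] by (simp add: q_def B_def I(3))
  qed
  have q: "\<bar>q g\<bar> \<le> 1" if "g \<in> M \<rightarrow>\<^sub>M count_space {-1, 1}" for g
  proof -
    have "\<bar>\<Sum>i\<in>I. corr M g (h i)\<bar> \<le> (\<Sum>i\<in>I. 1)"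
      using abs_corr_le_1[OF that h] by (intro order_trans[OF sum_abs] sum_mono)
    then show ?thesis using d by (simp add: q_def I(3))
  qed
  \<comment> \<open>The strict inequality in \<open>approximates\<close> is what contradicts the
    non-strict separation of the family.\<close>
  have unique: "i = j"
    if g: "g \<in> M \<rightarrow>\<^sub>M count_space {-1, 1}" and ij: "i \<in> I" "j \<in> I"
      and "approximates M \<epsilon> (h i) g" "approximates M \<epsilon> (h j) g" for g i j
  proof (rule ccontr)
    assume "i \<noteq> j"
    have sep: "\<bar>corr M (h i) (h j)\<bar> \<le> 1 - 2 * \<epsilon>" if "1 \<le> i" "i < j" "j \<le> d" for i j
      using fam that unfolding strong_SQ_family_def by blast
    have "\<bar>corr M (h i) (h j)\<bar> \<le> 1 - 2 * \<epsilon>"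
    proof (cases "i < j")
      case True
      then show ?thesis using sep[of i j] ij by (simp add: I_def)
    next
      case False
      then show ?thesis
        using sep[of j i] ij \<open>i \<noteq> j\<close> unfolding corr_commute[of M "h i" "h j"] by (simp add: I_def)
    qed
    then show False
      using approximates_imp_corr[OF h[OF ij(1)] g h[OF ij(2)] that(4,5)] by linarith
  qed
  \<comment> \<open>\<open>p > 0\<close> supplies the positivity required by
    \<open>success_prob_eq\<close>.\<close>
  have int: "integrable S (\<lambda>w. success_weight M \<epsilon> (h i) (A w) m [])"
    "p \<le> (\<integral>w. success_weight M \<epsilon> (h i) (A w) m [] \<partial>S)" if "i \<in> I" for i
    using success_prob_eq[where \<epsilon> = \<epsilon> and m = m, OF S.prob_space_axioms A h[OF that]]
      succ[OF hH[OF that]] p by auto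
  have "real d * p = (\<Sum>i\<in>I. p)" by (simp add: I)
  also have "\<dots> \<le> (\<Sum>i\<in>I. \<integral>w. success_weight M \<epsilon> (h i) (A w) m [] \<partial>S)"
    by (intro sum_mono int)
  also have "\<dots> = (\<integral>w. (\<Sum>i\<in>I. success_weight M \<epsilon> (h i) (A w) m []) \<partial>S)"
    using int by (intro Bochner_Integration.integral_sum[symmetric]) auto
  also have "\<dots> \<le> (\<integral>w. 1 + real m * B \<partial>S)"
  proof (intro integral_mono)
    fix w assume "w \<in> space S"
    then show "(\<Sum>i\<in>I. success_weight M \<epsilon> (h i) (A w) m []) \<le> 1 + real m * B"
      by (intro sum_success_weight_le[OF I(1) h A unique q dev]) (auto simp: B_def)
  qed (use int in auto)
  finally show ?thesis by (simp add: S.prob_space B_def)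
qed

section \<open>From families to the dimension\<close>

text \<open>The cube root of \<open>d\<close> is at most its square root, so failure of the claim
  gives \<open>m \<le> sqrt d / 12\<close>. With \<open>sqrt 3 \<le> 2\<close> the hypothesis
  becomes \<open>2 / 3 * d \<le> 1 + d / 12\<close>, which is false for such
  \<open>d\<close>.\<close>

lemma root_lt_of_success_bound:
  assumes d: "d \<ge> (11::nat)" and le: "real d * (2 / 3) \<le> 1 + real m * (sqrt (3 * real d) / 2)"
  shows "root 3 (real d) / 12 < real m"
proof (rule ccontr)
  assume "\<not> ?thesis"
  moreover have "root 3 (real d) \<le> sqrt (real d)"
    unfolding sqrt_def using d by (intro real_root_decreasing) auto
  ultimately have m: "real m \<le> sqrt (real d) / 12" by simp
  have "sqrt (3 * real d) \<le> 2 * sqrt (real d)"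
    by (simp add: real_sqrt_mult real_le_lsqrt mult_right_mono)
  then have "real m * (sqrt (3 * real d) / 2) \<le> sqrt (real d) / 12 * sqrt (real d)"
    using m by (intro mult_mono) auto
  then have "real d * (2 / 3) \<le> 1 + real d / 12" using le by simp
  then show False using d by simp
qed

theorem theorem9:
  fixes D :: "'x measure" and H :: "('x \<Rightarrow> real) set" and \<epsilon> :: real
    and S :: "'w measure" and A :: "'w \<Rightarrow> real list \<Rightarrow> ('x \<Rightarrow> real) action" and m :: nat
  assumes "prob_space D"
    and "hypothesis_class D H"
    and "\<epsilon> > 0"
    and "strong_SQ_dim D H (2 * \<epsilon>) \<ge> 11"
    and "sq_algorithm D H S A"
    and "\<And>t. t \<in> H \<Longrightarrow> success_prob D S A \<epsilon> m t \<ge> 2 / 3"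
  shows "case strong_SQ_dim D H (2 * \<epsilon>) of
           enat d \<Rightarrow> real m > root 3 (real d) / 12
         | \<infinity> \<Rightarrow> False"
proof -
  interpret prob_space D by fact
  define X where "X = {enat d |d. \<exists>h. strong_SQ_family D H (2 * \<epsilon>) d h}"
  \<comment> \<open>The bound is stated for every family size from 11 on, since there is no largest
    size when the dimension is infinite.\<close>
  have bound: "root 3 (real d) / 12 < real m" if X: "enat d \<in> X" and d: "d \<ge> 11" for d
  proof -
    obtain h where "strong_SQ_family D H (2 * \<epsilon>) d h"
      using X by (auto simp: X_def)
    then show ?thesis
      using strong_SQ_family_success_bound[of H d \<epsilon> h S A "2 / 3" m] assms d
      by (intro root_lt_of_success_bound) auto
  qed
  have dim: "strong_SQ_dim D H (2 * \<epsilon>) = Sup X"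
    by (simp add: strong_SQ_dim_def X_def)
  show ?thesis
  proof (cases "Sup X")
    case (enat d)
    then have d: "d \<ge> 11" using assms(4) dim by (simp add: numeral_eq_enat)
    \<comment> \<open>The default \<open>Sup {} = 0\<close> is excluded by
      \<open>d \<ge> 11\<close>, and an infinite set would have supremum \<open>\<infinity>\<close>.
      So the supremum is a maximum, attained by a family.\<close>
    then have "X \<noteq> {}" using enat by (auto simp: bot_enat_def zero_enat_def)
    moreover have "finite X"
      using enat by (metis Sup_enat_def calculation enat.distinct(1) infinity_enat_def)
    ultimately have "Sup X \<in> X" using Max_in by (auto simp: Sup_enat_def)
    then show ?thesis using bound[of d] d enat dim by simp
  next
    case infinity
    \<comment> \<open>A family with more than \<open>(12 * m) ^ 3\<close> members has cube root at
      least \<open>12 * m\<close>, contradicting \<open>bound\<close>; the 11 puts its size in the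
      range of \<open>bound\<close>.\<close>
    define N where "N = max 11 ((12 * m) ^ 3)"
    have "enat N < Sup X" using infinity by simp
    then obtain d where d: "enat d \<in> X" "enat N < enat d"
      unfolding less_Sup_iff unfolding X_def by blast
    have "12 * real m = root 3 (real ((12 * m) ^ 3))"
      using real_root_power_cancel[of 3 "12 * real m"]
      by (simp only: of_nat_power of_nat_mult of_nat_numeral)
    also have "\<dots> \<le> root 3 (real d)"
      using d(2) by (intro real_root_le_mono) (auto simp: N_def simp del: of_nat_power)
    finally show ?thesis using bound[OF d(1)] d(2) by (simp add: N_def)
  qed
qed

end
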